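(* Suppose that Lipschitz smoothness (constant $L_1$), unbiased stochastic gradients with variance bounded by $\sigma^2$, and bounded parameter variation (bound $\delta^2$) hold as defined in the context. Given the one-round bound $$\mathbb{E}[\mathcal{L}_{(t+1)E+0}]\le \mathcal{L}_{tE+0}+\Big(\frac{L_1\eta^2}{2}-\eta\Big)\sum_{e=0}^{E}\|\nabla\mathcal{L}_{tE+e}\|_2^2+\frac{L_1E\eta^2\sigma^2}{2}+\eta\delta^2$$ (for any client, after receiving the updated global homogeneous small model), for any client and an arbitrary constant $\epsilon>0$ the following holds: $$\frac1T\sum_{t=0}^{T-1}\sum_{e=0}^{E-1}\|\nabla\mathcal{L}_{tE+e}\|_2^2\le \frac{\frac1T\sum_{t=0}^{T-1}\big[\mathcal{L}_{tE+0}-\mathbb{E}[\mathcal{L}_{(t+1)E+0}]\big]+\frac{L_1E\eta^2\sigma^2}{2}+\eta\delta^2}{\eta-\frac{L_1\eta^2}{2}}<\epsilon,$$ subject to $$\eta<\frac{2(\epsilon-\delta^2)}{L_1(\epsilon+E\sigma^2)}.$$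
   Context: Setting: federated learning with a server and $N$ clients, indexed $k\in\{0,\dots,N-1\}$, over $T$ communication rounds $t\in\{0,\dots,T-1\}$. Client $k$ has local data $D_k$ and trains a whole local model with parameters $w_k$, consisting of a homogeneous small model with parameters $\theta$ (shared by all clients through the server), a private heterogeneous local model with parameters $\omega_k$, and a private representation projector with parameters $\varphi_k$. In each round the client receives the global small model from the server, performs $E$ local stochastic gradient iterations $w\leftarrow w-\eta g_w$ on its whole model, and uploads its updated small model $\theta_k^t$; the server aggregates the uploaded small models, as a data-size-weighted average, into the new global small model $\theta^t$. Here $\eta$ is the learning rate of the whole model (it stands for the learning rates of $\theta$, $\omega_k$ and $\varphi_k$). Indexing: $e\in\{0,1,\dots,E\}$ is the local iteration; $tE+0$ is the moment when the client has received the global small model from the server, before the local training of round $t+1$; $tE+e$ is the $e$-th iteration of the local training of round $t+1$; $tE+E$ is the end of that local training. $\mathcal{L}_{tE+e}$ and $\nabla\mathcal{L}_{tE+e}$ denote the client's loss and its gradient with respect to the whole model at that moment (the client index is dropped). $\mathbb{E}$ is expectation over the random batches. Assumptions. (i) Lipschitz smoothness: $\|\nabla\mathcal{L}_k^{t_1}(w_k^{t_1};x,y)-\nabla\mathcal{L}_k^{t_2}(w_k^{t_2};x,y)\|\le L_1\|w_k^{t_1}-w_k^{t_2}\|$ for all $t_1,t_2>0$, all $k$, and all $(x,y)\in D_k$; re-expressed as $\mathcal{L}_k^{t_1}-\mathcal{L}_k^{t_2}\le\langle\nabla\mathcal{L}_k^{t_2},w_k^{t_1}-w_k^{t_2}\rangle+\frac{L_1}{2}\|w_k^{t_1}-w_k^{t_2}\|_2^2$.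 (ii) Unbiased gradient and bounded variance: the random gradient $g_{w,k}^t=\nabla\mathcal{L}_k^t(w_k^t;\mathcal{B}_k^t)$ on a random batch $\mathcal{B}_k^t\subseteq D_k$ satisfies $\mathbb{E}[g_{w,k}^t]=\nabla\mathcal{L}_k^t(w_k^t)$ and $\mathbb{E}[\|\nabla\mathcal{L}_k^t(w_k^t;\mathcal{B}_k^t)-\nabla\mathcal{L}_k^t(w_k^t)\|_2^2]\le\sigma^2$. (iii) Bounded parameter variation: the small-model parameters $\theta_k^t$ before and $\theta^t$ after aggregation satisfy $\|\theta^t-\theta_k^t\|_2^2\le\delta^2$.
   Formalization: The "< ε" part can fail for fixed T, so it is proved only if the client's loss is bounded below and T > (L_0 − inf L)/(ε(η − L_1η²/2) − L_1Eη²σ²/2 − ηδ²); losses and squared gradients are read in total expectation. *)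

theory Defs
  imports "HOL-Probability.Probability"
begin

text \<open>
  The whole model of a client is a triple of (homogeneous small model, private heterogeneous model,
  private projector).  The private parameter spaces of different clients may have different
  dimensions; they are all regarded as coordinate subspaces of the common Euclidean spaces
  \<open>'b\<close> and \<open>'c\<close>, with the loss of a client not depending on its unused
  coordinates (so that these coordinates never change and do not contribute to any gradient).
\<close>

type_synonym ('a, 'b, 'c) model = "'a \<times> 'b \<times> 'c"

definition small_part :: "('a, 'b, 'c) model \<Rightarrow> 'a" where
  "small_part v = fst v"

definition private_part :: "('a, 'b, 'c) model \<Rightarrow> 'b \<times> 'c" where
  "private_part v = snd v"

definition grad :: "('v::real_inner \<Rightarrow> real) \<Rightarrow> 'v \<Rightarrow> 'v" where
  "grad f v = (THE d. GDERIV f v :> d)"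

definition mean_loss :: "('v \<Rightarrow> 'z \<Rightarrow> real) \<Rightarrow> 'z set \<Rightarrow> 'v \<Rightarrow> real" where
  "mean_loss l S v = (\<Sum>z\<in>S. l v z) / real (card S)"

definition local_loss :: "(nat \<Rightarrow> 'z set) \<Rightarrow> (nat \<Rightarrow> 'v \<Rightarrow> 'z \<Rightarrow> real) \<Rightarrow> nat \<Rightarrow> 'v \<Rightarrow> real" where
  "local_loss D l k = mean_loss (l k) (D k)"

definition aggregate :: "nat \<Rightarrow> (nat \<Rightarrow> 'z set) \<Rightarrow> (nat \<Rightarrow> 'a::real_vector) \<Rightarrow> 'a" where
  "aggregate N D th =
     (\<Sum>j<N. (real (card (D j)) / (\<Sum>i<N. real (card (D i)))) *\<^sub>R th j)"

text \<open>
  \<open>w k t e\<close> is the whole model of client \<open>k\<close> at the moment written \<open>tE + e\<close>, for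
  \<open>t < T\<close> and \<open>e \<le> E\<close>, or \<open>t = T\<close> and \<open>e = 0\<close>.
  The two indices are kept apart because \<open>tE + E\<close> (before aggregation)
  and \<open>(t+1)E + 0\<close> (after receiving the aggregated small model) are different moments.
  \<open>B k t e\<close> is the random batch used in the step from \<open>tE + e\<close> to \<open>tE + (e+1)\<close>.
  The random batches are the only source of randomness: the initial parameters are deterministic.
\<close>

locale federated_run = prob_space M
  for M :: "'o measure" +
  fixes N T E :: nat
    and D :: "nat \<Rightarrow> ('x \<times> 'y) set"
    and loss :: "nat \<Rightarrow> ('a::euclidean_space, 'b::euclidean_space, 'c::euclidean_space) model
                   \<Rightarrow> 'x \<times> 'y \<Rightarrow> real"
    and \<eta> :: real
    and \<theta>0 :: 'a
    and p0 :: "nat \<Rightarrow> 'b \<times> 'c"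
    and B :: "nat \<Rightarrow> nat \<Rightarrow> nat \<Rightarrow> 'o \<Rightarrow> ('x \<times> 'y) set"
    and w :: "nat \<Rightarrow> nat \<Rightarrow> nat \<Rightarrow> 'o \<Rightarrow> ('a, 'b, 'c) model"
  assumes T_pos: "T \<ge> 1"
    and E_pos: "E \<ge> 1"
    and eta_pos: "\<eta> > 0"
    and data: "k < N \<Longrightarrow> finite (D k) \<and> D k \<noteq> {}"
    and differentiable_loss: "k < N \<Longrightarrow> z \<in> D k \<Longrightarrow> (\<lambda>v. loss k v z) differentiable (at v)"
    and batch: "k < N \<Longrightarrow> t < T \<Longrightarrow> e < E \<Longrightarrow>
      B k t e \<in> measurable M (count_space {b. b \<subseteq> D k \<and> b \<noteq> {}})"
    and initial: "k < N \<Longrightarrow> \<xi> \<in> space M \<Longrightarrow> w k 0 0 \<xi> = (\<theta>0, p0 k)"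
    and local_step: "k < N \<Longrightarrow> t < T \<Longrightarrow> e < E \<Longrightarrow> \<xi> \<in> space M \<Longrightarrow>
      w k t (Suc e) \<xi> = w k t e \<xi> - \<eta> *\<^sub>R grad (mean_loss (loss k) (B k t e \<xi>)) (w k t e \<xi>)"
    and receive: "k < N \<Longrightarrow> t < T \<Longrightarrow> \<xi> \<in> space M \<Longrightarrow>
      w k (Suc t) 0 \<xi> = (aggregate N D (\<lambda>j. small_part (w j t E \<xi>)), private_part (w k t E \<xi>))"

definition moments :: "nat \<Rightarrow> nat \<Rightarrow> (nat \<times> nat) set" where
  "moments T E = {(t, e). t < T \<and> e \<le> E} \<union> {(T, 0)}"

text \<open>
  Smoothness is required between the models at any two moments
  after the initial one, in its gradient form (for every sample) and in its
  quadratic upper bound form (for the local loss).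
\<close>

definition lipschitz_smooth ::
  "'o measure \<Rightarrow> nat \<Rightarrow> nat \<Rightarrow> nat \<Rightarrow> (nat \<Rightarrow> 'z set) \<Rightarrow> (nat \<Rightarrow> 'v::euclidean_space \<Rightarrow> 'z \<Rightarrow> real)
     \<Rightarrow> (nat \<Rightarrow> nat \<Rightarrow> nat \<Rightarrow> 'o \<Rightarrow> 'v) \<Rightarrow> real \<Rightarrow> bool" where
  "lipschitz_smooth M N T E D loss w L1 \<longleftrightarrow>
     (\<forall>k<N. \<forall>(t1, e1) \<in> moments T E - {(0, 0)}. \<forall>(t2, e2) \<in> moments T E - {(0, 0)}.
        AE \<xi> in M.
          (\<forall>z\<in>D k. norm (grad (\<lambda>v. loss k v z) (w k t1 e1 \<xi>) - grad (\<lambda>v. loss k v z) (w k t2 e2 \<xi>))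
                     \<le> L1 * norm (w k t1 e1 \<xi> - w k t2 e2 \<xi>)) \<and>
          local_loss D loss k (w k t1 e1 \<xi>) - local_loss D loss k (w k t2 e2 \<xi>)
            \<le> grad (local_loss D loss k) (w k t2 e2 \<xi>) \<bullet> (w k t1 e1 \<xi> - w k t2 e2 \<xi>)
                + L1 / 2 * (norm (w k t1 e1 \<xi> - w k t2 e2 \<xi>))\<^sup>2)"

text \<open>
  The expectation over the random batch is taken with the current model given, i.e. conditionally on
  the \<open>\<sigma>\<close>-algebra generated by the current model.  Conditional expectations are
  available for real functions only, so the vector identity is stated coordinatewise.
\<close>

definition stochastic_gradients ::
  "'o measure \<Rightarrow> nat \<Rightarrow> nat \<Rightarrow> nat \<Rightarrow> (nat \<Rightarrow> 'z set) \<Rightarrow> (nat \<Rightarrow> 'v::euclidean_space \<Rightarrow> 'z \<Rightarrow> real)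
     \<Rightarrow> (nat \<Rightarrow> nat \<Rightarrow> nat \<Rightarrow> 'o \<Rightarrow> 'z set) \<Rightarrow> (nat \<Rightarrow> nat \<Rightarrow> nat \<Rightarrow> 'o \<Rightarrow> 'v) \<Rightarrow> real \<Rightarrow> bool" where
  "stochastic_gradients M N T E D loss B w \<sigma> \<longleftrightarrow>
     (\<forall>k<N. \<forall>t<T. \<forall>e<E.
        let G = vimage_algebra (space M) (w k t e) borel;
            g = (\<lambda>\<xi>. grad (mean_loss (loss k) (B k t e \<xi>)) (w k t e \<xi>));
            h = (\<lambda>\<xi>. grad (local_loss D loss k) (w k t e \<xi>))
        in (\<forall>i\<in>Basis. AE \<xi> in M. real_cond_exp M G (\<lambda>\<xi>. g \<xi> \<bullet> i) \<xi> = h \<xi> \<bullet> i) \<and>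
           (AE \<xi> in M. real_cond_exp M G (\<lambda>\<xi>. (norm (g \<xi> - h \<xi>))\<^sup>2) \<xi> \<le> \<sigma>\<^sup>2))"

definition bounded_variation ::
  "'o measure \<Rightarrow> nat \<Rightarrow> nat \<Rightarrow> nat \<Rightarrow> (nat \<Rightarrow> 'z set)
     \<Rightarrow> (nat \<Rightarrow> nat \<Rightarrow> nat \<Rightarrow> 'o \<Rightarrow> ('a::euclidean_space, 'b, 'c) model) \<Rightarrow> real \<Rightarrow> bool" where
  "bounded_variation M N T E D w \<delta> \<longleftrightarrow>
     (\<forall>k<N. \<forall>t<T. AE \<xi> in M.
        (norm (aggregate N D (\<lambda>j. small_part (w j t E \<xi>)) - small_part (w k t E \<xi>)))\<^sup>2 \<le> \<delta>\<^sup>2)"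

text \<open>
  Losses and gradients at moments after the initial one depend on the earlier random batches; the
  expectations are taken over all random batches of the run.
\<close>

definition exp_loss ::
  "'o measure \<Rightarrow> (nat \<Rightarrow> 'z set) \<Rightarrow> (nat \<Rightarrow> 'v \<Rightarrow> 'z \<Rightarrow> real)
     \<Rightarrow> (nat \<Rightarrow> nat \<Rightarrow> nat \<Rightarrow> 'o \<Rightarrow> 'v) \<Rightarrow> nat \<Rightarrow> nat \<Rightarrow> nat \<Rightarrow> real" where
  "exp_loss M D loss w k t e = (\<integral>\<xi>. local_loss D loss k (w k t e \<xi>) \<partial>M)"

definition exp_sq_grad ::
  "'o measure \<Rightarrow> (nat \<Rightarrow> 'z set) \<Rightarrow> (nat \<Rightarrow> 'v::real_inner \<Rightarrow> 'z \<Rightarrow> real)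
     \<Rightarrow> (nat \<Rightarrow> nat \<Rightarrow> nat \<Rightarrow> 'o \<Rightarrow> 'v) \<Rightarrow> nat \<Rightarrow> nat \<Rightarrow> nat \<Rightarrow> real" where
  "exp_sq_grad M D loss w k t e =
     (\<integral>\<xi>. (norm (grad (local_loss D loss k) (w k t e \<xi>)))\<^sup>2 \<partial>M)"

end

theory Submission
  imports Defs
begin

text \<open>
  The hypothesis on \<open>\<eta>\<close> says that
  \<open>\<epsilon> (\<eta> - L1 \<eta>\<^sup>2 / 2)\<close> exceeds the
  error \<open>L1 E \<eta>\<^sup>2 \<sigma>\<^sup>2 / 2 + \<eta> \<delta>\<^sup>2\<close> of one
  round; in particular \<open>\<eta> - L1 \<eta>\<^sup>2 / 2\<close> is positive, so the one-round bound can
  be solved for the gradient sum and averaged over the rounds.  The averaged decrease of the loss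
  telescopes, and its last term is at least the infimum of the loss.  This last step needs the
  loss to be integrable, since a Bochner integral that does not exist is \<open>0\<close>.  Gradients need
  not be measurable functions of the model, but a batch takes finitely many values, hence so
  does every model of the run.
\<close>

lemma simple_function_measurable_count_space:
  assumes "f \<in> measurable M (count_space A)" and "finite A"
  shows "simple_function M f"
  unfolding simple_function_def
proof
  have sub: "f ` space M \<subseteq> A"
    using measurable_space[OF assms(1)] by auto
  then show "finite (f ` space M)"
    using assms(2) by (rule finite_subset)
  show "\<forall>x\<in>f ` space M. f -` {x} \<inter> space M \<in> sets M"
  proof
    fix x assume "x \<in> f ` space M"
    then have "{x} \<in> sets (count_space A)"
      using sub by auto
    then show "f -` {x} \<inter> space M \<in> sets M"
      by (rule measurable_sets[OF assms(1)])
  qed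
qed

text \<open>A finite range is bounded, and a bounded measurable function is integrable for a finite
  measure.\<close>

lemma (in finite_measure) integrable_simple_function_real:
  fixes f :: "'a \<Rightarrow> real"
  assumes "simple_function M f"
  shows "integrable M f"
proof -
  have "bounded (f ` space M)"
    using assms by (simp add: simple_functionD(1) finite_imp_bounded)
  then obtain b where "\<And>x. x \<in> space M \<Longrightarrow> norm (f x) \<le> b"
    by (auto simp: bounded_iff)
  then show ?thesis
    by (intro integrable_const_bound[where B = b] AE_I2)
      (auto intro: borel_measurable_simple_function assms)
qed

context federated_run
begin

lemma simple_function_batch:
  assumes "k < N" "t < T" "e < E"
  shows "simple_function M (B k t e)"
proof (rule simple_function_measurable_count_space)
  show "B k t e \<in> measurable M (count_space {b. b \<subseteq> D k \<and> b \<noteq> {}})"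
    using assms by (rule batch)
  show "finite {b. b \<subseteq> D k \<and> b \<noteq> {}}"
    using data[OF assms(1)] by (auto intro: finite_subset[of _ "Pow (D k)"])
qed

text \<open>One update is a fixed map applied to the pair of batch and model, and composition with
  an arbitrary map preserves simple functions.\<close>

lemma simple_function_local:
  assumes "k < N" "t < T" "simple_function M (w k t 0)" "e \<le> E"
  shows "simple_function M (w k t e)"
  using \<open>e \<le> E\<close>
proof (induction e)
  case 0
  show ?case by (rule assms(3))
next
  case (Suc e)
  then have e: "e < E" and IH: "simple_function M (w k t e)"
    by auto
  have "simple_function M (\<lambda>\<xi>. (\<lambda>(b, v). v - \<eta> *\<^sub>R grad (mean_loss (loss k) b) v) (B k t e \<xi>, w k t e \<xi>))"
    by (rule simple_function_compose1[OF simple_function_Pair[OF simple_function_batch[OF assms(1,2) e] IH]])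
  then show ?case
    by (simp add: local_step[OF assms(1,2) e] cong: simple_function_cong)
qed

lemma simple_function_round:
  assumes "k < N" "t \<le> T"
  shows "simple_function M (w k t 0)"
  using assms
\<comment> \<open>\<open>k\<close> is generalised because the small model received in the next round
  averages the small models of all clients.\<close>
proof (induction t arbitrary: k)
  case 0
  show ?case
    by (simp add: initial[OF 0(1)] cong: simple_function_cong)
next
  case (Suc t)
  then have t: "t < T" by simp
  have E: "simple_function M (w j t E)" if "j < N" for j
    using that t by (intro simple_function_local[OF _ _ Suc.IH]) auto
  have "simple_function M (\<lambda>\<xi>. (real (card (D j)) / (\<Sum>i<N. real (card (D i)))) *\<^sub>R small_part (w j t E \<xi>))"
    if "j < N" for j
    using E[OF that] by (rule simple_function_compose1)
  then have "simple_function M (\<lambda>\<xi>. aggregate N D (\<lambda>j. small_part (w j t E \<xi>)))"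
    unfolding aggregate_def by (intro simple_function_sum) simp
  moreover have "simple_function M (\<lambda>\<xi>. private_part (w k t E \<xi>))"
    using E[OF Suc.prems(1)] by (rule simple_function_compose1)
  ultimately have "simple_function M
      (\<lambda>\<xi>. (aggregate N D (\<lambda>j. small_part (w j t E \<xi>)), private_part (w k t E \<xi>)))"
    by (rule simple_function_Pair)
  then show ?case
    by (simp add: receive[OF Suc.prems(1) t] cong: simple_function_cong)
qed

text \<open>\<open>bdd_below\<close> makes the infimum a genuine lower bound of the loss; this
  pointwise bound passes to the mean because \<open>M\<close> is a probability measure.\<close>

lemma exp_loss_ge_INF:
  assumes "k < N" "t \<le> T" "bdd_below (range (local_loss D loss k))"
  shows "(INF v. local_loss D loss k v) \<le> exp_loss M D loss w k t 0"
  unfolding exp_loss_def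
proof (rule integral_ge_const)
  show "integrable M (\<lambda>\<xi>. local_loss D loss k (w k t 0 \<xi>))"
    using simple_function_round[OF assms(1,2)]
    by (intro integrable_simple_function_real) (rule simple_function_compose1)
  show "AE \<xi> in M. (INF v. local_loss D loss k v) \<le> local_loss D loss k (w k t 0 \<xi>)"
    using assms(3) by (auto intro: cINF_lower)
qed

end

text \<open>Clearing the positive denominator and multiplying by \<open>\<eta>\<close> gives twice
  the claim, up to moving \<open>\<epsilon> * L * \<eta>\<^sup>2\<close> across. The intended values
  are \<open>real E * \<sigma>\<^sup>2\<close> for \<open>s\<close> and
  \<open>\<delta>\<^sup>2\<close> for \<open>d\<close>.\<close>

lemma step_size_bound:
  fixes \<eta> L \<epsilon> s d :: real
  assumes "\<eta> > 0" "L > 0" "\<epsilon> > 0" "s \<ge> 0"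
    and "\<eta> < 2 * (\<epsilon> - d) / (L * (\<epsilon> + s))"
  shows "L * s * \<eta>\<^sup>2 / 2 + \<eta> * d < \<epsilon> * (\<eta> - L * \<eta>\<^sup>2 / 2)"
proof -
  have "0 < L * (\<epsilon> + s)"
    using assms by simp
  then have "\<eta> * (L * (\<epsilon> + s)) < 2 * (\<epsilon> - d)"
    using assms(5) by (simp add: pos_less_divide_eq)
  then have "\<eta> * (\<eta> * (L * (\<epsilon> + s))) < \<eta> * (2 * (\<epsilon> - d))"
    using \<open>\<eta> > 0\<close> by (rule mult_strict_left_mono)
  then show ?thesis
    by (simp add: algebra_simps power2_eq_square)
qed

theorem theorem2:
  fixes M :: "'o measure"
    and N T E k :: nat
    and D :: "nat \<Rightarrow> ('x \<times> 'y) set"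
    and loss :: "nat \<Rightarrow> ('a::euclidean_space, 'b::euclidean_space, 'c::euclidean_space) model
                   \<Rightarrow> 'x \<times> 'y \<Rightarrow> real"
    and \<theta>0 :: 'a
    and p0 :: "nat \<Rightarrow> 'b \<times> 'c"
    and B :: "nat \<Rightarrow> nat \<Rightarrow> nat \<Rightarrow> 'o \<Rightarrow> ('x \<times> 'y) set"
    and w :: "nat \<Rightarrow> nat \<Rightarrow> nat \<Rightarrow> 'o \<Rightarrow> ('a, 'b, 'c) model"
    and \<eta> L1 \<sigma> \<delta> \<epsilon> :: real
  assumes run: "federated_run M N T E D loss \<eta> \<theta>0 p0 B w"
    and L1_pos: "L1 > 0"
    and smooth: "lipschitz_smooth M N T E D loss w L1"
    and unbiased: "stochastic_gradients M N T E D loss B w \<sigma>"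
    and variation: "bounded_variation M N T E D w \<delta>"
    and one_round: "\<And>j t. j < N \<Longrightarrow> t < T \<Longrightarrow>
      exp_loss M D loss w j (t + 1) 0
        \<le> exp_loss M D loss w j t 0
          + (L1 * \<eta>\<^sup>2 / 2 - \<eta>) * (\<Sum>e = 0..E. exp_sq_grad M D loss w j t e)
          + L1 * real E * \<eta>\<^sup>2 * \<sigma>\<^sup>2 / 2 + \<eta> * \<delta>\<^sup>2"
    and client: "k < N"
    and eps_pos: "\<epsilon> > 0"
    and eta_bound: "\<eta> < 2 * (\<epsilon> - \<delta>\<^sup>2) / (L1 * (\<epsilon> + real E * \<sigma>\<^sup>2))"
  shows
    "(1 / real T) * (\<Sum>t = 0..<T. \<Sum>e = 0..<E. exp_sq_grad M D loss w k t e)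
       \<le> ((1 / real T) * (\<Sum>t = 0..<T. exp_loss M D loss w k t 0 - exp_loss M D loss w k (t + 1) 0)
            + L1 * real E * \<eta>\<^sup>2 * \<sigma>\<^sup>2 / 2 + \<eta> * \<delta>\<^sup>2) / (\<eta> - L1 * \<eta>\<^sup>2 / 2)
     \<and> (bdd_below (range (local_loss D loss k)) \<and>
        real T > (exp_loss M D loss w k 0 0 - (INF v. local_loss D loss k v))
                 / (\<epsilon> * (\<eta> - L1 * \<eta>\<^sup>2 / 2) - L1 * real E * \<eta>\<^sup>2 * \<sigma>\<^sup>2 / 2 - \<eta> * \<delta>\<^sup>2)
        \<longrightarrow> ((1 / real T) * (\<Sum>t = 0..<T. exp_loss M D loss w k t 0 - exp_loss M D loss w k (t + 1) 0)
              + L1 * real E * \<eta>\<^sup>2 * \<sigma>\<^sup>2 / 2 + \<eta> * \<delta>\<^sup>2) / (\<eta> - L1 * \<eta>\<^sup>2 / 2) < \<epsilon>)"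
proof -
  interpret federated_run M N T E D loss \<eta> \<theta>0 p0 B w by (rule run)
  let ?c = "\<eta> - L1 * \<eta>\<^sup>2 / 2"
  let ?K = "L1 * real E * \<eta>\<^sup>2 * \<sigma>\<^sup>2 / 2 + \<eta> * \<delta>\<^sup>2"
  let ?F = "\<lambda>t. exp_loss M D loss w k t 0"
  let ?G = "\<lambda>t e. exp_sq_grad M D loss w k t e"
  let ?S = "\<Sum>t = 0..<T. ?F t - ?F (t + 1)"
  have T: "real T > 0"
    using T_pos by simp
  have K: "?K < \<epsilon> * ?c"
    using step_size_bound[OF eta_pos L1_pos eps_pos _ eta_bound] by (simp add: mult_ac)
  \<comment> \<open>The sign of \<open>?c\<close> is read off from \<open>0 \<le> ?K\<close> and
    \<open>?K < \<epsilon> * ?c\<close>.\<close>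
  have "0 \<le> ?K"
    using eta_pos L1_pos by simp
  then have "0 < \<epsilon> * ?c"
    using K by (rule order.strict_trans1)
  then have c: "?c > 0"
    using eps_pos by (rule zero_less_mult_pos)
  have "(\<Sum>e = 0..<E. ?G t e) * ?c \<le> ?F t - ?F (t + 1) + ?K" if "t < T" for t
  proof -
    \<comment> \<open>The one-round bound also counts the moment \<open>e = E\<close> at the end of
      local training; its squared gradient is nonnegative and may be dropped.\<close>
    have "(\<Sum>e = 0..<E. ?G t e) \<le> (\<Sum>e = 0..E. ?G t e)"
      by (intro sum_mono2) (auto simp: exp_sq_grad_def)
    then have "(\<Sum>e = 0..<E. ?G t e) * ?c \<le> (\<Sum>e = 0..E. ?G t e) * ?c"
      using c by (intro mult_right_mono) auto
    \<comment> \<open>The factor of the gradient sum in \<open>one_round\<close> is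
      \<open>- ?c\<close>, so that sum moves to the left with factor \<open>?c\<close>.\<close>
    also have "\<dots> \<le> ?F t - ?F (t + 1) + ?K"
      using one_round[OF client that] by (simp add: algebra_simps)
    finally show ?thesis .
  qed
  then have "(\<Sum>t = 0..<T. (\<Sum>e = 0..<E. ?G t e) * ?c) \<le> (\<Sum>t = 0..<T. ?F t - ?F (t + 1) + ?K)"
    by (intro sum_mono) auto
  also have "\<dots> = ?S + real T * ?K"
    by (subst sum.distrib) simp
  finally have "(\<Sum>t = 0..<T. \<Sum>e = 0..<E. ?G t e) * ?c \<le> ?S + real T * ?K"
    by (simp only: sum_distrib_right[where r = ?c])
  then have "(1 / real T) * ((\<Sum>t = 0..<T. \<Sum>e = 0..<E. ?G t e) * ?c) \<le> (1 / real T) * (?S + real T * ?K)"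
    using T by (intro mult_left_mono) auto
  also have "\<dots> = (1 / real T) * ?S + ?K"
    using T by (simp add: distrib_left)
  finally have bound: "(1 / real T) * (\<Sum>t = 0..<T. \<Sum>e = 0..<E. ?G t e) \<le> ((1 / real T) * ?S + ?K) / ?c"
    using c by (simp only: pos_le_divide_eq mult.assoc)
  have small: "((1 / real T) * ?S + ?K) / ?c < \<epsilon>"
    if bdd: "bdd_below (range (local_loss D loss k))"
      and T_large: "(?F 0 - (INF v. local_loss D loss k v)) / (\<epsilon> * ?c - ?K) < real T"
  proof -
    have "?S = ?F 0 - ?F T"
      using sum_lessThan_telescope'[of ?F T] by (simp add: atLeast0LessThan)
    also have "\<dots> \<le> ?F 0 - (INF v. local_loss D loss k v)"
      using exp_loss_ge_INF[OF client order_refl bdd] by simp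
    \<comment> \<open>By \<open>K\<close> the gap \<open>\<epsilon> * ?c - ?K\<close> is positive,
      so the threshold on \<open>T\<close> can be cleared of its denominator. It is chosen so that
      the average decrease of the loss stays below this gap.\<close>
    also have "\<dots> < real T * (\<epsilon> * ?c - ?K)"
      using T_large K by (simp only: pos_divide_less_eq diff_gt_0_iff_gt)
    finally have "?S / real T < \<epsilon> * ?c - ?K"
      using T by (simp only: pos_divide_less_eq mult.commute)
    then have "(1 / real T) * ?S + ?K < \<epsilon> * ?c"
      by simp
    then show ?thesis
      using c by (simp only: pos_divide_less_eq)
  qed
  show ?thesis
    \<comment> \<open>The statement lists the two terms of \<open>?K\<close> separately;
      reassociation collects them on both sides.\<close>
    using bound small by (simp only: add.assoc diff_diff_add) blast
qed

end
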